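(* Let $G$ be a connected block graph and let $f: V(G)\to\{0,1,2,\dots\}$ be a regular vertex labeling of $G$. Then $\mathrm{ip}_f(G)=\lceil s(G)/2\rceil$, where $s(G)=\sum_{v\in V(G)} f(v)$.
   Context: Graphs are finite, simple and nonempty. A block graph is a graph in which every block (maximal connected subgraph without a cut-vertex of its own) is a complete graph. A cut-vertex of a graph is a vertex whose removal results in a graph with more components than the original graph; a non-cut-vertex is a vertex that is not a cut-vertex. An isometric path between two vertices of $G$ is a shortest path in $G$ joining them; the two vertices may coincide, so a single vertex is an isometric path (of length 0). A vertex labeling of $G$ is a function $f$ assigning to each vertex $v$ a non-negative integer $f(v)$. It is called regular if $f(v)\ge 1$ for every non-cut-vertex $v$ of $G$. An $f$-isometric-path cover of $G$ is a family $\mathcal{C}$ (repetitions allowed, i.e. a multiset) of isometric paths of $G$ such that: (C1) if $f(v)=0$, then $v$ lies on some path in $\mathcal{C}$; (C2) if $f(v)\ge 1$, then $v$ is an end vertex of at least $f(v)$ paths in $\mathcal{C}$, counted with multiplicity, where each copy of the single-vertex path $v$ in $\mathcal{C}$ counts twice. The $f$-isometric-path number $\mathrm{ip}_f(G)$ is the minimum cardinality (with multiplicity) of an $f$-isometric-path cover of $G$. *)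

theory Defs
  imports Complex_Main "HOL-Library.Multiset" "Graph_Theory.Graph_Theory"
begin

text \<open>
  Finite simple graphs are taken as \<^const>\<open>graph\<close>: finite symmetric digraphs without loops and
  parallel arcs, one pair of opposite arcs for each edge. The locale admits the null graph;
  \<^const>\<open>Digraph_Component.connected\<close> excludes it.
\<close>

text \<open>For symmetric digraphs, the strong components are the components of the undirected graph.\<close>

definition cut_vertex :: "('a, 'b) pre_digraph \<Rightarrow> 'a \<Rightarrow> bool" where
  "cut_vertex G v \<longleftrightarrow> v \<in> verts G \<and>
     card (pre_digraph.sccs G) < card (pre_digraph.sccs (pre_digraph.del_vert G v))"

text \<open>The conjunct \<open>graph H\<close> restricts the sub-digraphs to the undirected subgraphs.\<close>

definition block :: "('a, 'b) pre_digraph \<Rightarrow> ('a, 'b) pre_digraph \<Rightarrow> bool" where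
  "block G B \<longleftrightarrow> pre_digraph.max_subgraph G
     (\<lambda>H. graph H \<and> Digraph_Component.connected H \<and> \<not> (\<exists>v. cut_vertex H v)) B"

definition block_graph :: "('a, 'b) pre_digraph \<Rightarrow> bool" where
  "block_graph G \<longleftrightarrow> graph G \<and> (\<forall>B. block G B \<longrightarrow> (\<exists>n. complete_digraph n B))"

text \<open>
  A path is given by its list of vertices in one of its two directions. A list and its reversal
  describe the same path, but nothing below depends on the direction chosen: vertices, ends and
  the cardinality of a multiset are unaffected by reversing some of its members.
\<close>

definition isometric_path :: "('a, 'b) pre_digraph \<Rightarrow> 'a vwalk \<Rightarrow> bool" where
  "isometric_path G p \<longleftrightarrow> vpath p G \<and>
     (\<forall>q. vpath q G \<and> hd q = hd p \<and> last q = last p \<longrightarrow> vwalk_length p \<le> vwalk_length q)"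

definition regular_labeling :: "('a, 'b) pre_digraph \<Rightarrow> ('a \<Rightarrow> nat) \<Rightarrow> bool" where
  "regular_labeling G f \<longleftrightarrow> (\<forall>v \<in> verts G. \<not> cut_vertex G v \<longrightarrow> 1 \<le> f v)"

definition end_mult :: "'a \<Rightarrow> 'a vwalk \<Rightarrow> nat" where
  "end_mult v p = (if p = [v] then 2 else if v = hd p \<or> v = last p then 1 else 0)"

definition isometric_path_cover ::
    "('a, 'b) pre_digraph \<Rightarrow> ('a \<Rightarrow> nat) \<Rightarrow> 'a vwalk multiset \<Rightarrow> bool" where
  "isometric_path_cover G f C \<longleftrightarrow>
     (\<forall>p \<in># C. isometric_path G p) \<and>
     (\<forall>v \<in> verts G. f v = 0 \<longrightarrow> (\<exists>p \<in># C. v \<in> set p)) \<and>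
     (\<forall>v \<in> verts G. 1 \<le> f v \<longrightarrow> f v \<le> (\<Sum>p \<in># C. end_mult v p))"

text \<open>The minimum exists: enough copies of all single-vertex paths form a cover.\<close>

definition isometric_path_number :: "('a, 'b) pre_digraph \<Rightarrow> ('a \<Rightarrow> nat) \<Rightarrow> nat" where
  "isometric_path_number G f = (LEAST k. \<exists>C. isometric_path_cover G f C \<and> size C = k)"

end

theory Submission
  imports Defs
begin

text \<open>
  Each path has at most two ends, which gives the lower bound. For the upper bound, list every
  vertex \<open>v\<close> with multiplicity \<open>f v\<close>, adding one arbitrary vertex if \<open>s(G)\<close> is odd, and pair the
  entries of this list so that the sum of the distances of the pairs is maximal; join each pair by
  an isometric path. A vertex \<open>v\<close> with \<open>f v = 0\<close> is a cut-vertex, and every component of \<open>G - v\<close>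
  contains a non-cut-vertex of \<open>G\<close>, hence an entry of the list. If no path passed through \<open>v\<close>, then
  two pairs \<open>(a, b)\<close> and \<open>(c, d)\<close> would lie in different components of \<open>G - v\<close>. In a block graph,
  \<open>d(a, b) < d(a, v) + d(v, b)\<close> whenever \<open>a\<close> and \<open>b\<close> are in the same component of \<open>G - v\<close>, so
  the exchange to \<open>(a, c)\<close> and \<open>(b, d)\<close> would increase the sum.
\<close>


section \<open>Distances, and walks that avoid a vertex\<close>

text \<open>Minimising over walks rather than paths lets walks be joined and cut without restoring
  distinctness. If no walk exists, \<open>LEAST\<close> is unspecified; hence the reachability
  hypotheses below.\<close>

definition (in pre_digraph) vdist :: "'a \<Rightarrow> 'a \<Rightarrow> nat" where
  "vdist u v = (LEAST n. \<exists>p. vwalk p G \<and> hd p = u \<and> last p = v \<and> vwalk_length p = n)"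

lemma (in pre_digraph) vdist_le:
  assumes "vwalk p G"
  shows "vdist (hd p) (last p) \<le> vwalk_length p"
  unfolding vdist_def using assms by (blast intro: Least_le)

lemma length_vwalk_to_vpath: "length (vwalk_to_vpath p) \<le> length p"
proof (induct p rule: vwalk_to_vpath_induct3)
  case (in_set x xs)
  then show ?case
    using length_dropWhile_le[of "\<lambda>y. y \<noteq> x" xs] by simp
qed auto

context wf_digraph
begin

text \<open>Removing the cycles of a shortest walk does not lengthen it, so the minimum is attained
  by a path. The length is that of the vertex list, one more than the number of arcs, which also
  makes \<open>p\<close> nonempty.\<close>

lemma shortest_vpathE:
  assumes "u \<rightarrow>\<^sup>* v"
  obtains p where "vpath p G" "hd p = u" "last p = v" "length p = Suc (vdist u v)"
proof -
  have "\<exists>n p. vwalk p G \<and> hd p = u \<and> last p = v \<and> vwalk_length p = n"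
    using assms reachable_vwalk_conv by simp
  from LeastI_ex[OF this] obtain p
    where p: "vwalk p G" "hd p = u" "last p = v" "vwalk_length p = vdist u v"
    unfolding vdist_def by blast
  let ?q = "vwalk_to_vpath p"
  have q: "vpath ?q G" "hd ?q = u" "last ?q = v"
    using p by (simp_all add: vwalk_to_vpath_vpath vwalk_to_vpath_hd vwalk_to_vpath_last)
  have "length ?q \<le> Suc (vdist u v)"
    using length_vwalk_to_vpath[of p] p by simp
  moreover have "vdist u v \<le> length ?q - 1"
    using vdist_le[of ?q] q by auto
  moreover have "?q \<noteq> []"
    using q(1) by auto
  ultimately have "length ?q = Suc (vdist u v)"
    by (cases ?q) auto
  with q show thesis by (rule that)
qed

lemma isometric_pathI:
  assumes "vpath p G" "length p = Suc (vdist (hd p) (last p))"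
  shows "isometric_path G p"
  unfolding isometric_path_def
proof (intro conjI allI impI)
  fix q assume q: "vpath q G \<and> hd q = hd p \<and> last q = last p"
  then have "vdist (hd p) (last p) \<le> vwalk_length q"
    using vdist_le[of q] by auto
  then show "vwalk_length p \<le> vwalk_length q"
    using assms(2) by simp
qed (rule assms)

lemma vdist_triangle:
  assumes "u \<rightarrow>\<^sup>* v" "v \<rightarrow>\<^sup>* w"
  shows "vdist u w \<le> vdist u v + vdist v w"
proof -
  from assms(1) obtain p where p: "vpath p G" "hd p = u" "last p = v" "length p = Suc (vdist u v)"
    by (rule shortest_vpathE)
  from assms(2) obtain q where q: "vpath q G" "hd q = v" "last q = w" "length q = Suc (vdist v w)"
    by (rule shortest_vpathE)
  have join: "joinable p q"
    using p q by (auto simp: joinable_def)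
  then have "vwalk (p \<oplus> q) G"
    using p q by (auto intro: vwalk_joinI_vwalk)
  from vdist_le[OF this] show ?thesis
    using join p q by (simp add: vwalk_join_hd vwalk_join_last) (simp add: vwalk_join_def)
qed

lemma vdist_split:
  assumes "vwalk p G" "v \<in> set p"
  shows "vdist (hd p) v + vdist v (last p) \<le> vwalk_length p"
proof -
  obtain q r where qr: "p = q @ v # r"
    using split_list[OF assms(2)] by blast
  have "vwalk (q @ [v]) G" "vwalk (v # r) G"
    using assms(1) vwalkI_append_l[of "q @ [v]" r G] vwalkI_append_r[of "v # r" q G]
    by (simp_all add: qr)
  from this[THEN vdist_le] show ?thesis
    by (cases q) (simp_all add: qr)
qed

lemma vdist_self: "v \<in> verts G \<Longrightarrow> vdist v v = 0"
  using vdist_le[of "[v]"] by simp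

lemma vdist_eq_0D:
  assumes "u \<rightarrow>\<^sup>* v" "vdist u v = 0"
  shows "u = v"
proof -
  from assms(1) obtain p where "hd p = u" "last p = v" "length p = Suc (vdist u v)"
    by (rule shortest_vpathE)
  then show ?thesis
    using assms(2) by (cases p) auto
qed

lemma vdist_adj: "u \<rightarrow>\<^bsub>G\<^esub> v \<Longrightarrow> vdist u v \<le> 1"
  using vdist_le[of "[u, v]"] adj_in_verts[of u v] by simp

text \<open>Used mainly in contrapositive form: if two vertices are not connected in
  \<open>del_vert v\<close>, every walk between them passes through \<open>v\<close>.\<close>

lemma reachable_del_vertI:
  assumes "vwalk p G" "v \<notin> set p"
  shows "hd p \<rightarrow>\<^sup>*\<^bsub>del_vert v\<^esub> last p"
proof -
  interpret D: wf_digraph "del_vert v"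
    by (rule wf_digraph_del_vert)
  have "set (vwalk_arcs p) \<subseteq> arcs_ends (del_vert v)"
  proof
    fix e assume e: "e \<in> set (vwalk_arcs p)"
    then have "e \<in> arcs_ends G" "e \<in> set p \<times> set p"
      using assms(1) arcs_in_vwalk_arcs[of e p] by blast+
    then show "e \<in> arcs_ends (del_vert v)"
      using assms(2) by (auto simp: arcs_ends_conv del_vert_simps)
  qed
  then have "vwalk p (del_vert v)"
    using assms by (auto simp: vwalk_def del_vert_simps)
  then show ?thesis
    by (auto simp: D.reachable_vwalk_conv)
qed

lemma adj_del_vert: "u \<rightarrow>\<^bsub>G\<^esub> w \<Longrightarrow> u \<noteq> v \<Longrightarrow> w \<noteq> v \<Longrightarrow> u \<rightarrow>\<^bsub>del_vert v\<^esub> w"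
  by (auto simp: arcs_ends_conv del_vert_simps)

text \<open>A shortest path from \<open>u\<close> to \<open>w\<close> must pass through
  \<open>v\<close>, so its length splits there. The cases \<open>u = v\<close> and
  \<open>w = v\<close> are included, since \<open>v\<close> is unreachable in
  \<open>del_vert v\<close>.\<close>

lemma vdist_separated:
  assumes "u \<rightarrow>\<^sup>* w" "\<not> u \<rightarrow>\<^sup>*\<^bsub>del_vert v\<^esub> w"
  shows "vdist u v + vdist v w \<le> vdist u w"
proof -
  from assms(1) obtain p where p: "vpath p G" "hd p = u" "last p = w" "length p = Suc (vdist u w)"
    by (rule shortest_vpathE)
  then have "v \<in> set p"
    using reachable_del_vertI[of p v] assms(2) by auto
  then show ?thesis
    using vdist_split[of p v] p by auto
qed

text \<open>Take for \<open>w\<close> the last vertex but one of a shortest path. The vertices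
  before \<open>v\<close> on a path differ from \<open>v\<close>, so \<open>w\<close> stays in the
  component of \<open>u\<close> after \<open>v\<close> is deleted.\<close>

lemma vdist_last_stepE:
  assumes "u \<rightarrow>\<^sup>* v" "u \<noteq> v"
  obtains w where "u \<rightarrow>\<^sup>*\<^bsub>del_vert v\<^esub> w" "w \<rightarrow>\<^bsub>G\<^esub> v" "vdist u v = Suc (vdist u w)"
proof -
  from assms(1) obtain p where p: "vpath p G" "hd p = u" "last p = v" "length p = Suc (vdist u v)"
    by (rule shortest_vpathE)
  define q where "q = butlast p"
  have pq: "p = q @ [v]" "q \<noteq> []"
  proof -
    show "p = q @ [v]"
      using p(3,4) append_butlast_last_id[of p] unfolding q_def by fastforce
    then show "q \<noteq> []"
      using p assms(2) by auto
  qed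
  have hdq: "hd q = u"
    using p(2) pq by simp
  have vq: "vwalk q G" "v \<notin> set q"
    using p(1) pq by (auto intro: vwalkI_append_l)
  have adj: "last q \<rightarrow>\<^bsub>G\<^esub> v"
    using p(1) pq by (auto simp: vpath_def vwalk_def set_vwalk_arcs_snoc)
  have 1: "u \<rightarrow>\<^sup>*\<^bsub>del_vert v\<^esub> last q"
    using reachable_del_vertI[OF vq] hdq by simp
  have "vdist u (last q) \<le> vdist u v - 1"
    using vdist_le[OF vq(1)] hdq p(4) pq by simp
  moreover have "vdist u v \<le> vdist u (last q) + 1"
  proof -
    have "u \<rightarrow>\<^sup>* last q"
      using vq(1) hdq by (auto simp: reachable_vwalk_conv)
    from vdist_triangle[OF this reachable_adjI[OF adj]] vdist_adj[OF adj] show ?thesis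
      by simp
  qed
  \<comment> \<open>This excludes truncation of the subtraction in the first bound.\<close>
  moreover have "vdist u v \<noteq> 0"
    using vdist_eq_0D assms by blast
  ultimately have "vdist u v = Suc (vdist u (last q))"
    by simp
  with 1 adj show thesis by (rule that)
qed

end

lemma (in sym_digraph) vdist_commute:
  assumes "u \<rightarrow>\<^sup>* v"
  shows "vdist u v = vdist v u"
proof -
  have le: "vdist y x \<le> vdist x y" if "x \<rightarrow>\<^sup>* y" for x y
  proof -
    from that obtain p where p: "vpath p G" "hd p = x" "last p = y" "length p = Suc (vdist x y)"
      by (rule shortest_vpathE)
    then have "vwalk (rev p) G"
      using vwalk_rev_ex[OF sym_arcs] by auto
    from vdist_le[OF this] show ?thesis
      using p by (simp add: hd_rev last_rev)
  qed
  show ?thesis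
    using le[OF assms] le[OF symmetric_reachable'[OF assms]] by simp
qed

text \<open>A crude bound whose purpose is to guarantee that maximal distances and maximal sums of
  distances exist.\<close>

lemma (in fin_digraph) vdist_le_card:
  assumes "u \<rightarrow>\<^sup>* v"
  shows "vdist u v \<le> card (verts G)"
proof -
  from assms obtain p where p: "vpath p G" "length p = Suc (vdist u v)"
    by (rule shortest_vpathE)
  then have "length p = card (set p)"
    by (auto simp: distinct_card)
  also have "\<dots> \<le> card (verts G)"
    using p by (auto intro!: card_mono elim!: vpathE)
  finally show ?thesis using p by simp
qed

section \<open>Connectedness and cut-vertices in terms of reachability\<close>

context graph
begin

lemma graph_induced:
  assumes "induced_subgraph H G"
  shows "graph H"
proof -
  interpret H: digraph H
    using assms by (rule digraphI_induced)
  show ?thesis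
    by (rule H.graphI[OF induced_graph_imp_symmetric[OF sym_arcs assms]])
qed

lemma graph_del_vert: "graph (del_vert v)"
proof (rule graph_induced)
  show "induced_subgraph (del_vert v) G"
    using subgraph_del_vert by (auto simp: induced_subgraph_def del_vert_simps)
qed

lemma connected_iff:
  "connected G \<longleftrightarrow> verts G \<noteq> {} \<and> (\<forall>u \<in> verts G. \<forall>v \<in> verts G. u \<rightarrow>\<^sup>* v)"
proof
  assume "connected G"
  then have "strongly_connected G"
    by (rule symmetric_connected_imp_strongly_connected[OF sym_arcs])
  then show "verts G \<noteq> {} \<and> (\<forall>u \<in> verts G. \<forall>v \<in> verts G. u \<rightarrow>\<^sup>* v)"
    by (simp add: strongly_connected_def)
qed (auto intro!: connectedI reachable_mk_symmetricI)

lemma card_sccs_connected: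
  assumes "verts G \<noteq> {}" "\<And>u v. u \<in> verts G \<Longrightarrow> v \<in> verts G \<Longrightarrow> u \<rightarrow>\<^sup>* v"
  shows "card sccs = 1"
proof -
  have "scc_of ` verts G = {verts G}"
    using assms by (auto simp: scc_of_def dest: reachable_in_verts)
  then show ?thesis
    by (simp add: card_sccs_verts[symmetric] sccs_verts_conv_scc_of)
qed

lemma card_sccs_disconnected:
  assumes "u \<in> verts G" "v \<in> verts G" "\<not> u \<rightarrow>\<^sup>* v"
  shows "1 < card sccs"
proof -
  have "scc_of u \<noteq> scc_of v"
    using assms in_scc_of_self[of v] by (auto simp: scc_of_def)
  then have "card {scc_of u, scc_of v} = 2"
    by simp
  moreover have "card {scc_of u, scc_of v} \<le> card (scc_of ` verts G)"
    using assms by (intro card_mono) auto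
  ultimately show ?thesis
    by (simp add: card_sccs_verts[symmetric] sccs_verts_conv_scc_of)
qed

text \<open>A connected graph has exactly one component, so the count grows precisely when two
  remaining vertices are separated.\<close>

lemma cut_vertex_iff:
  assumes "connected G"
  shows "cut_vertex G v \<longleftrightarrow> v \<in> verts G \<and>
    (\<exists>x \<in> verts G - {v}. \<exists>y \<in> verts G - {v}. \<not> x \<rightarrow>\<^sup>*\<^bsub>del_vert v\<^esub> y)"
proof -
  interpret D: graph "del_vert v"
    by (rule graph_del_vert)
  have 1: "card sccs = 1"
    using assms card_sccs_connected by (simp add: connected_iff)
  have "1 < card D.sccs \<longleftrightarrow> (\<exists>x \<in> verts G - {v}. \<exists>y \<in> verts G - {v}. \<not> x \<rightarrow>\<^sup>*\<^bsub>del_vert v\<^esub> y)"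
    (is "?L \<longleftrightarrow> ?R")
  proof
    assume ?L
    show ?R
    proof (rule ccontr)
      assume R: "\<not> ?R"
      show False
      \<comment> \<open>Deleting the only vertex of a graph leaves the null graph, which has no
        components rather than one.\<close>
      proof (cases "verts (del_vert v) = {}")
        case True
        then show False
          using \<open>?L\<close> by (simp add: D.card_sccs_verts[symmetric] D.sccs_verts_conv_scc_of)
      next
        case False
        then have "card D.sccs = 1"
          by (rule D.card_sccs_connected) (use R in \<open>auto simp: del_vert_simps\<close>)
        then show False
          using \<open>?L\<close> by simp
      qed
    qed
  next
    assume ?R
    then obtain x y where "x \<in> verts G - {v}" "y \<in> verts G - {v}" "\<not> x \<rightarrow>\<^sup>*\<^bsub>del_vert v\<^esub> y"
      by blast
    then show ?L
      by (intro D.card_sccs_disconnected[of x y]) (simp_all add: del_vert_simps)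
  qed
  then show ?thesis
    by (simp add: cut_vertex_def 1)
qed

end

section \<open>Extension to maximal subgraphs\<close>

text \<open>Among the subgraphs that satisfy \<open>P\<close> and contain \<open>H\<close>, one with
  the most vertices plus arcs is maximal. This provides a block around any connected subgraph
  without a cut-vertex.\<close>

lemma (in fin_digraph) ex_max_subgraph:
  assumes "subgraph H G" "P H"
  obtains B where "max_subgraph P B" "subgraph H B"
proof -
  let ?m = "\<lambda>K. card (verts K) + card (arcs K)"
  let ?Q = "\<lambda>K. subgraph K G \<and> P K \<and> subgraph H K"
  have mono: "card (verts K) \<le> card (verts L) \<and> card (arcs K) \<le> card (arcs L)"
    if "subgraph K L" "subgraph L G" for K L
  proof -
    interpret L: fin_digraph L
      using that(2) by (rule fin_digraph_subgraph)
    show ?thesis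
      using that(1) by (simp add: subgraph_def card_mono)
  qed
  have "?Q H"
    using assms by (simp add: subgraph_def compatible_def)
  moreover have "\<forall>K. ?Q K \<longrightarrow> ?m K < Suc (?m G)"
    using mono[of _ G] subgraph_refl by (simp add: less_Suc_eq_le add_mono)
  ultimately have "\<exists>B. ?Q B \<and> (\<forall>K. ?Q K \<longrightarrow> ?m K \<le> ?m B)"
    by (rule ex_has_greatest_nat)
  then obtain B where "?Q B \<and> (\<forall>K. ?Q K \<longrightarrow> ?m K \<le> ?m B)" ..
  then have B: "?Q B" and max: "\<forall>K. ?Q K \<longrightarrow> ?m K \<le> ?m B"
    by (rule conjunct1, rule conjunct2)
  have "max_subgraph P B"
  proof (rule max_subgraphI)
    fix K assume K: "B \<noteq> K" "subgraph B K" "subgraph K G"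
    show "\<not> P K"
    proof
      assume "P K"
      then have "?m K \<le> ?m B"
        using B K subgraph_trans[of H B K] by (intro max[rule_format]) simp
      then have eq: "card (verts B) = card (verts K)" "card (arcs B) = card (arcs K)"
        using mono[OF K(2,3)] by linarith+
      interpret K: fin_digraph K
        using K(3) by (rule fin_digraph_subgraph)
      have "verts B = verts K" "arcs B = arcs K"
        using K(2) eq by (simp_all add: subgraph_def card_subset_eq)
      \<comment> \<open>Compatibility makes the \<open>tail\<close> and \<open>head\<close>
        functions agree, so the records coincide.\<close>
      then have "B = K"
        using K(2) by (simp add: subgraph_def compatible_def)
      then show False
        using K(1) by blast
    qed
  qed (use B in blast)+
  then show thesis
    using that B by blast
qed

lemma (in wf_digraph) vwalk_reachable:
  assumes "vwalk p G" "y \<in> set p"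
  shows "hd p \<rightarrow>\<^sup>* y" "y \<rightarrow>\<^sup>* last p"
proof -
  obtain q r where qr: "p = q @ y # r"
    using split_list[OF assms(2)] by blast
  have "vwalk (q @ [y]) G" "vwalk (y # r) G"
    using assms(1) vwalkI_append_l[of "q @ [y]" r G] vwalkI_append_r[of "y # r" q G]
    by (simp_all add: qr)
  moreover have "hd (q @ [y]) = hd p" "last (y # r) = last p"
    by (simp_all add: qr hd_append)
  ultimately show "hd p \<rightarrow>\<^sup>* y" "y \<rightarrow>\<^sup>* last p"
    unfolding reachable_vwalk_conv by (metis last_snoc, metis list.sel(1))
qed

section \<open>Distances in block graphs and the existence of non-cut-vertices\<close>

context graph
begin

lemma connected_if_reachable:
  assumes "v \<in> verts G" "\<And>u. u \<in> verts G \<Longrightarrow> u \<rightarrow>\<^sup>* v"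
  shows "connected G"
  unfolding connected_iff using assms symmetric_reachable' reachable_trans by blast

text \<open>By symmetry of reachability, one common target \<open>x\<close> connects any two
  remaining vertices.\<close>

lemma not_cut_vertexI:
  assumes "connected G" "\<And>u. u \<in> verts G - {v} \<Longrightarrow> u \<rightarrow>\<^sup>*\<^bsub>del_vert v\<^esub> x"
  shows "\<not> cut_vertex G v"
proof -
  interpret D: graph "del_vert v"
    by (rule graph_del_vert)
  show ?thesis
    unfolding cut_vertex_iff[OF assms(1)]
    using assms(2) D.symmetric_reachable' D.reachable_trans by blast
qed

text \<open>
  A path from \<open>u\<close> to \<open>w\<close> avoiding \<open>v\<close> closes up, through \<open>v\<close>, to a cycle. A cycle has no
  cut-vertex, so it lies in a single block.
\<close>

lemma block_graph_neighbours_adjacent: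
  assumes bg: "block_graph G"
    and adj: "u \<rightarrow>\<^bsub>G\<^esub> v" "w \<rightarrow>\<^bsub>G\<^esub> v" and uw: "u \<rightarrow>\<^sup>*\<^bsub>del_vert v\<^esub> w" "u \<noteq> w"
  shows "u \<rightarrow>\<^bsub>G\<^esub> w"
proof -
  interpret D: graph "del_vert v"
    by (rule graph_del_vert)
  obtain p where p: "vpath p (del_vert v)" "hd p = u" "last p = w"
    using uw(1) D.reachable_vpath_conv by auto
  have pG: "vwalk p G" "distinct p"
    using p(1) vwalkI_subgraph[OF _ subgraph_del_vert] by auto
  have vp: "v \<notin> set p"
    using p(1) by (auto simp: vpath_def vwalk_def del_vert_simps)
  have ends: "u \<in> set p" "w \<in> set p"
    using p pG(1) by (auto simp: vwalk_def)
  define S where "S = insert v (set p)"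
  define H where "H = G \<restriction> S"
  have SG: "S \<subseteq> verts G"
    using pG(1) adj adj_in_verts by (auto simp: S_def)
  then have ind: "induced_subgraph H G"
    unfolding H_def by (rule induced_induce)
  then have graphH: "graph H"
    by (rule graph_induced)
  interpret H: graph H
    by (rule graphH)
  have vertsH: "verts H = S"
    by (simp add: H_def)
  have adjH: "a \<rightarrow>\<^bsub>H\<^esub> b" if "a \<rightarrow>\<^bsub>G\<^esub> b" "a \<in> S" "b \<in> S" for a b
    using that by (auto simp: arcs_ends_conv H_def)
  have uvH: "u \<rightarrow>\<^bsub>H\<^esub> v" and wvH: "w \<rightarrow>\<^bsub>H\<^esub> v"
    using adj ends by (auto intro!: adjH simp: S_def)
  have "set (vwalk_arcs p) \<subseteq> arcs_ends H"
  proof (rule subrelI)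
    fix a b assume ab: "(a, b) \<in> set (vwalk_arcs p)"
    then have "a \<rightarrow>\<^bsub>G\<^esub> b"
      using pG(1) by auto
    moreover have "a \<in> S" "b \<in> S"
      using in_set_vwalk_arcsE[OF ab] by (auto simp: S_def)
    ultimately show "a \<rightarrow>\<^bsub>H\<^esub> b"
      by (rule adjH)
  qed
  then have pH: "vwalk p H"
    using pG(1) by (auto simp: vwalk_def vertsH S_def)
  have connH: "connected H"
  proof (rule H.connected_if_reachable)
    fix y assume y: "y \<in> verts H"
    show "y \<rightarrow>\<^sup>*\<^bsub>H\<^esub> v"
    proof (cases "y = v")
      case True
      then show ?thesis using y by simp
    next
      case False
      then have "y \<rightarrow>\<^sup>*\<^bsub>H\<^esub> w"
        using H.vwalk_reachable(2)[OF pH] y p(3) by (simp add: vertsH S_def)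
      then show ?thesis
        using wvH by (rule H.reachable_adj_trans)
    qed
  qed (simp add: vertsH S_def)
  have no_cut: "\<not> cut_vertex H x" for x
  proof (cases "x \<in> S")
    case False
    then show ?thesis by (simp add: cut_vertex_def vertsH)
  next
    case xS: True
    interpret K: graph "H.del_vert x"
      by (rule H.graph_del_vert)
    have walk: "hd q \<rightarrow>\<^sup>*\<^bsub>H.del_vert x\<^esub> last q" if "vwalk q H" "x \<notin> set q" for q
      using that by (rule H.reachable_del_vertI)
    show ?thesis
    proof (cases "x = v")
      \<comment> \<open>Deleting \<open>v\<close> leaves the path \<open>p\<close>, along which
        every vertex reaches \<open>w\<close>.\<close>
      case True
      show ?thesis
      proof (rule H.not_cut_vertexI[OF connH])
        fix y assume "y \<in> verts H - {x}"
        then have "y \<in> set p"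
          using True by (simp add: vertsH S_def)
        then obtain q r where qr: "p = q @ y # r"
          using split_list by fastforce
        have "vwalk (y # r) H"
          using pH vwalkI_append_r[of "y # r" q H] by (simp add: qr)
        from walk[OF this] show "y \<rightarrow>\<^sup>*\<^bsub>H.del_vert x\<^esub> w"
          using vp True p(3) by (simp add: qr)
      qed
    next
      case False
      \<comment> \<open>Deleting \<open>x\<close> cuts \<open>p\<close> into \<open>q\<close> and
        \<open>r\<close>. From \<open>q\<close> one goes back to \<open>u\<close> and on to
        \<open>v\<close>, from \<open>r\<close> forward to \<open>w\<close> and on to
        \<open>v\<close>. Either piece may be empty.\<close>
      then obtain q r where qr: "p = q @ x # r"
        using xS split_list[of x p] by (auto simp: S_def)
      show ?thesis
      proof (rule H.not_cut_vertexI[OF connH])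
        fix y assume y: "y \<in> verts H - {x}"
        consider "y = v" | "y \<in> set q" | "y \<in> set r"
          using y by (auto simp: vertsH S_def qr)
        then show "y \<rightarrow>\<^sup>*\<^bsub>H.del_vert x\<^esub> v"
        proof cases
          case 1
          then show ?thesis
            using y by (simp add: H.del_vert_simps)
        next
          case 2
          then obtain q1 q2 where q: "q = q1 @ y # q2"
            using split_list by fastforce
          have "vwalk (q1 @ [y]) H"
            using pH vwalkI_append_l[of "q1 @ [y]" "q2 @ x # r" H] by (simp add: qr q)
          moreover have "hd (q1 @ [y]) = u"
            using p(2) by (cases q1) (simp_all add: qr q)
          ultimately have "u \<rightarrow>\<^sup>*\<^bsub>H.del_vert x\<^esub> y"
            using walk[of "q1 @ [y]"] pG(2) by (auto simp: qr q)
          then have "y \<rightarrow>\<^sup>*\<^bsub>H.del_vert x\<^esub> u"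
            by (rule K.symmetric_reachable')
          moreover have "u \<noteq> x"
            using pG(2) p(2) 2 by (cases q) (auto simp: qr)
          then have "u \<rightarrow>\<^bsub>H.del_vert x\<^esub> v"
            using uvH False by (intro H.adj_del_vert) auto
          ultimately show ?thesis
            by (rule K.reachable_adj_trans)
        next
          case 3
          then obtain r1 r2 where r: "r = r1 @ y # r2"
            using split_list by fastforce
          have "vwalk (y # r2) H"
            using pH vwalkI_append_r[of "y # r2" "q @ x # r1" H] by (simp add: qr r)
          then have "y \<rightarrow>\<^sup>*\<^bsub>H.del_vert x\<^esub> w"
            using walk[of "y # r2"] pG(2) p(3) by (auto simp: qr r)
          moreover have "w \<noteq> x"
            using pG(2) p(3) 3 by (cases r rule: rev_cases) (auto simp: qr)
          then have "w \<rightarrow>\<^bsub>H.del_vert x\<^esub> v"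
            using wvH False by (intro H.adj_del_vert) auto
          ultimately show ?thesis
            by (rule K.reachable_adj_trans)
        qed
      qed
    qed
  qed
  obtain B where B: "block G B" "subgraph H B"
    unfolding block_def
  proof (rule ex_max_subgraph[of H "\<lambda>H. graph H \<and> connected H \<and> \<not> (\<exists>v. cut_vertex H v)"])
    show "subgraph H G"
      using ind by (rule induced_imp_subgraph)
    show "graph H \<and> connected H \<and> \<not> (\<exists>v. cut_vertex H v)"
      using connH no_cut graphH by blast
  qed
  then obtain n where "complete_digraph n B"
    using bg by (auto simp: block_graph_def)
  moreover have "u \<in> verts B" "w \<in> verts B"
    using B(2) ends by (auto simp: subgraph_def vertsH S_def)
  ultimately have "u \<rightarrow>\<^bsub>B\<^esub> w"
    using uw(2) by (simp add: complete_digraph_def)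
  moreover have "subgraph B G"
    using B(1) by (simp add: block_def max_subgraph_def)
  ultimately show ?thesis
    by (rule adj_mono)
qed

text \<open>Shortest paths from \<open>x\<close> and \<open>y\<close> to \<open>v\<close> enter
  \<open>v\<close> from neighbours \<open>u\<close> and \<open>w\<close> in the same component of
  \<open>del_vert v\<close>. These are equal or adjacent, so going from \<open>u\<close> to
  \<open>w\<close> directly saves at least one step over the detour through
  \<open>v\<close>.\<close>

lemma block_graph_vdist_less:
  assumes bg: "block_graph G" and conn: "connected G"
    and v: "v \<in> verts G" and xy: "x \<rightarrow>\<^sup>*\<^bsub>del_vert v\<^esub> y"
  shows "vdist x y < vdist x v + vdist v y"
proof -
  interpret D: graph "del_vert v"
    by (rule graph_del_vert)
  have reach: "a \<rightarrow>\<^sup>* b" if "a \<in> verts G" "b \<in> verts G" for a b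
    using conn that by (simp add: connected_iff)
  have xyv: "x \<in> verts G" "y \<in> verts G" "x \<noteq> v" "y \<noteq> v"
    using D.reachable_in_verts[OF xy] by (auto simp: del_vert_simps)
  obtain u where u: "x \<rightarrow>\<^sup>*\<^bsub>del_vert v\<^esub> u" "u \<rightarrow>\<^bsub>G\<^esub> v" "vdist x v = Suc (vdist x u)"
    using vdist_last_stepE[OF reach] xyv v by metis
  obtain w where w: "y \<rightarrow>\<^sup>*\<^bsub>del_vert v\<^esub> w" "w \<rightarrow>\<^bsub>G\<^esub> v" "vdist y v = Suc (vdist y w)"
    using vdist_last_stepE[OF reach] xyv v by metis
  have "u \<rightarrow>\<^sup>*\<^bsub>del_vert v\<^esub> w"
    using u(1) xy w(1) D.symmetric_reachable' D.reachable_trans by blast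
  then have "u = w \<or> u \<rightarrow>\<^bsub>G\<^esub> w"
    using block_graph_neighbours_adjacent[OF bg u(2) w(2)] by blast
  then have "vdist u w \<le> 1"
    using vdist_self vdist_adj u(2) adj_in_verts by force
  moreover have "u \<in> verts G" "w \<in> verts G"
    using u(2) w(2) adj_in_verts by auto
  moreover from this have "vdist x y \<le> vdist x u + vdist u y" "vdist u y \<le> vdist u w + vdist w y"
    using xyv reach vdist_triangle by auto
  ultimately show ?thesis
    using u(3) w(3) vdist_commute[OF reach] xyv v by simp
qed

text \<open>A vertex of the component at maximal distance from \<open>v\<close> is not a cut-vertex.\<close>

lemma non_cut_vertex_reachableE:
  assumes conn: "connected G" and v: "v \<in> verts G" and x: "x \<in> verts G" "x \<noteq> v"
  obtains y where "x \<rightarrow>\<^sup>*\<^bsub>del_vert v\<^esub> y" "y \<in> verts G" "\<not> cut_vertex G y"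
proof -
  interpret D: graph "del_vert v"
    by (rule graph_del_vert)
  let ?C = "\<lambda>y. x \<rightarrow>\<^sup>*\<^bsub>del_vert v\<^esub> y"
  have reach: "a \<rightarrow>\<^sup>* b" if "a \<in> verts G" "b \<in> verts G" for a b
    using conn that by (simp add: connected_iff)
  have C_verts: "y \<in> verts G \<and> y \<noteq> v" if "?C y" for y
    using D.reachable_in_verts(2)[OF that] by (simp add: del_vert_simps)
  have "?C x"
    using x by (simp add: del_vert_simps)
  moreover have "\<forall>y. ?C y \<longrightarrow> vdist y v < Suc (card (verts G))"
    using C_verts v reach vdist_le_card by (simp add: less_Suc_eq_le)
  ultimately have "\<exists>y. ?C y \<and> (\<forall>z. ?C z \<longrightarrow> vdist z v \<le> vdist y v)"
    by (rule ex_has_greatest_nat)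
  then obtain y where y: "?C y" and max: "\<And>z. ?C z \<Longrightarrow> vdist z v \<le> vdist y v"
    by blast
  have yv: "y \<in> verts G" "y \<noteq> v"
    using C_verts y by auto
  have "\<not> cut_vertex G y"
  proof (rule not_cut_vertexI[OF conn])
    fix z assume z: "z \<in> verts G - {y}"
    show "z \<rightarrow>\<^sup>*\<^bsub>del_vert y\<^esub> v"
    proof (rule ccontr)
      assume "\<not> ?thesis"
      \<comment> \<open>If deleting \<open>y\<close> separates \<open>z\<close> from
        \<open>v\<close>, then \<open>y\<close> lies between them. For \<open>z\<close> in the
        component this makes \<open>z\<close> farther from \<open>v\<close> than
        \<open>y\<close>.\<close>
      then have 1: "vdist z y + vdist y v \<le> vdist z v"
        using z v reach by (intro vdist_separated) auto
      show False
      proof (cases "?C z")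
        case True
        then have "vdist z y = 0"
          using max 1 by fastforce
        then show False
          using vdist_eq_0D[OF reach] z yv by blast
      next
        \<comment> \<open>Now \<open>v\<close> also lies between \<open>z\<close> and
          \<open>y\<close>, possibly with \<open>z = v\<close>. Adding both inequalities forces
          \<open>vdist v y = 0\<close>.\<close>
        case False
        then have "\<not> z \<rightarrow>\<^sup>*\<^bsub>del_vert v\<^esub> y"
          using y D.symmetric_reachable' D.reachable_trans by blast
        then have "vdist z v + vdist v y \<le> vdist z y"
          using z yv reach by (intro vdist_separated) auto
        then have "vdist v y = 0"
          using 1 by simp
        then show False
          using vdist_eq_0D[OF reach] v yv by blast
      qed
    qed
  qed
  with y yv(1) show thesis
    by (intro that)
qed

end

section \<open>Pairings of maximal total distance\<close>

text \<open>A pairing is encoded as a multiset of ordered pairs whose projections add up to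
  \<open>M\<close>. Pairs with equal entries are allowed and later give single-vertex paths.\<close>

lemma ex_pairing:
  assumes "even (size M)"
  shows "\<exists>P. image_mset fst P + image_mset snd P = M"
  using assms
proof (induction "size M" arbitrary: M rule: less_induct)
  case less
  show ?case
  proof (cases "M = {#}")
    case False
    then obtain a N where N: "M = add_mset a N"
      by (meson multiset_cases)
    with less.prems have "N \<noteq> {#}"
      by auto
    then obtain b L where L: "N = add_mset b L"
      by (meson multiset_cases)
    obtain P where "image_mset fst P + image_mset snd P = L"
      using less.hyps[of L] less.prems by (auto simp: N L)
    then have "image_mset fst (add_mset (a, b) P) + image_mset snd (add_mset (a, b) P) = M"
      by (simp add: N L)
    then show ?thesis ..
  qed simp
qed

text \<open>The maximality that selects \<open>P\<close> does not refer to \<open>v\<close>, so a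
  single pairing serves all cut-vertices at once.\<close>

lemma (in graph) separating_pairingE:
  assumes bg: "block_graph G" and conn: "connected G"
    and M: "set_mset M \<subseteq> verts G" "even (size M)"
      "\<And>v. v \<in> verts G \<Longrightarrow> \<not> cut_vertex G v \<Longrightarrow> v \<in># M"
  obtains P where "image_mset fst P + image_mset snd P = M"
    "\<And>v. cut_vertex G v \<Longrightarrow> \<exists>(a, b) \<in># P. \<not> a \<rightarrow>\<^sup>*\<^bsub>del_vert v\<^esub> b"
proof -
  let ?Q = "\<lambda>P. image_mset fst P + image_mset snd P = M"
  let ?W = "\<lambda>P. \<Sum>(a, b) \<in># P. vdist a b"
  have reach: "a \<rightarrow>\<^sup>* b" if "a \<in> verts G" "b \<in> verts G" for a b
    using conn that by (simp add: connected_iff)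
  have verts: "a \<in> verts G \<and> b \<in> verts G" if "?Q P" "(a, b) \<in># P" for P a b
  proof -
    have "a \<in># M" "b \<in># M"
      using that(2) unfolding that(1)[symmetric] by force+
    then show ?thesis using M(1) by auto
  qed
  obtain P0 where "?Q P0"
    using ex_pairing[OF M(2)] by blast
  moreover have "\<forall>P. ?Q P \<longrightarrow> ?W P < Suc (size M * card (verts G))"
  proof (intro allI impI)
    fix P :: "('a \<times> 'a) multiset" assume P: "?Q P"
    have "?W P \<le> (\<Sum>_ \<in># P. card (verts G))"
      using verts[OF P] reach vdist_le_card by (intro sum_mset_mono) auto
    also have "\<dots> = size P * card (verts G)"
      by simp
    also have "\<dots> \<le> size M * card (verts G)"
      unfolding P[symmetric] by simp
    finally show "?W P < Suc (size M * card (verts G))"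
      by simp
  qed
  ultimately have "\<exists>P. ?Q P \<and> (\<forall>P'. ?Q P' \<longrightarrow> ?W P' \<le> ?W P)"
    by (rule ex_has_greatest_nat)
  then obtain P where P: "?Q P" and max: "\<And>P'. ?Q P' \<Longrightarrow> ?W P' \<le> ?W P"
    by blast
  have "\<exists>(a, b) \<in># P. \<not> a \<rightarrow>\<^sup>*\<^bsub>del_vert v\<^esub> b" if cut: "cut_vertex G v" for v
  proof (rule ccontr)
    interpret D: graph "del_vert v"
      by (rule graph_del_vert)
    let ?R = "\<lambda>a b. a \<rightarrow>\<^sup>*\<^bsub>del_vert v\<^esub> b"
    assume "\<not> ?thesis"
    \<comment> \<open>In particular \<open>v\<close> is not an entry of any pair, since it is not a
      vertex of \<open>del_vert v\<close>.\<close>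
    then have same: "?R a b" if "(a, b) \<in># P" for a b
      using that by blast
    have R_sym: "?R a b \<Longrightarrow> ?R b a" for a b
      by (rule D.symmetric_reachable')
    obtain x0 y0 where v: "v \<in> verts G" and x0: "x0 \<in> verts G" "x0 \<noteq> v"
      and y0: "y0 \<in> verts G" "y0 \<noteq> v" and "\<not> ?R x0 y0"
      using cut unfolding cut_vertex_iff[OF conn] by blast
    obtain x where x: "?R x0 x" "x \<in> verts G" "\<not> cut_vertex G x"
      by (rule non_cut_vertex_reachableE[OF conn v x0])
    obtain y where y: "?R y0 y" "y \<in> verts G" "\<not> cut_vertex G y"
      by (rule non_cut_vertex_reachableE[OF conn v y0])
    have xy: "\<not> ?R x y"
      using \<open>\<not> ?R x0 y0\<close> x(1) y(1) R_sym D.reachable_trans by blast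
    have pair: "\<exists>a b. (a, b) \<in># P \<and> ?R a z \<and> ?R b z" if z: "z \<in> verts G" "\<not> cut_vertex G z" for z
    proof -
      have "z \<in># image_mset fst P + image_mset snd P"
        using M(3) z P by simp
      then obtain a b where ab: "(a, b) \<in># P" "z = a \<or> z = b"
        by auto
      from same[OF ab(1)] have "?R a b" "?R b a" "?R a a" "?R b b"
        using R_sym D.reachable_in_verts by auto
      with ab show ?thesis by blast
    qed
    obtain a b where ab: "(a, b) \<in># P" "?R a x" "?R b x"
      using pair[OF x(2,3)] by blast
    obtain c d where cd: "(c, d) \<in># P" "?R c y" "?R d y"
      using pair[OF y(2,3)] by blast
    have sep: "\<not> ?R a c" "\<not> ?R b d"
      using ab cd xy R_sym D.reachable_trans by blast+
    \<comment> \<open>Distinctness ensures that both pairs can be removed from \<open>P\<close>,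
      even if each occurs only once.\<close>
    have "(a, b) \<noteq> (c, d)"
      using sep(1) same[OF ab(1)] D.reachable_in_verts(1) by auto
    then have "(c, d) \<in># P - {#(a, b)#}"
      using cd(1) by (auto simp: in_diff_count)
    then obtain Q where Q: "P = add_mset (a, b) (add_mset (c, d) Q)"
      using ab(1) by (metis insert_DiffM)
    \<comment> \<open>Both new pairs are separated by \<open>v\<close>, so their distances sum to at
      least the four distances to \<open>v\<close>. The old pairs stay within components, and their
      sum is strictly smaller.\<close>
    let ?P = "add_mset (a, c) (add_mset (b, d) Q)"
    have "?Q ?P"
      using P by (simp add: Q add_mset_commute)
    from max[OF this] have "vdist a c + vdist b d \<le> vdist a b + vdist c d"
      by (simp add: Q)
    moreover have abcd: "a \<in> verts G" "b \<in> verts G" "c \<in> verts G" "d \<in> verts G"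
      using verts[OF P] ab(1) cd(1) by auto
    then have "vdist a v + vdist v c \<le> vdist a c" "vdist b v + vdist v d \<le> vdist b d"
      using reach sep by (auto intro: vdist_separated)
    moreover have "vdist a b < vdist a v + vdist v b" "vdist c d < vdist c v + vdist v d"
      using block_graph_vdist_less[OF bg conn v] same ab(1) cd(1) by auto
    moreover have "vdist v b = vdist b v" "vdist v c = vdist c v"
      using vdist_commute[OF reach] v abcd by auto
    ultimately show False
      by linarith
  qed
  with P show thesis
    by (rule that)
qed

section \<open>Counting path ends and building a cover\<close>

text \<open>The vertices of a path are distinct, so its first and last vertices coincide only for a
  single-vertex path. Counting the two ends separately then gives the value 2.\<close>

lemma end_mult_vpath:
  assumes "vpath p G"
  shows "end_mult v p = of_bool (hd p = v) + of_bool (last p = v)"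
proof (cases p)
  case Nil
  then show ?thesis using assms by auto
next
  case (Cons a q)
  then show ?thesis
    using assms by (cases q rule: rev_cases) (auto simp: end_mult_def vpath_def)
qed

lemma sum_end_mult_le:
  assumes "finite V" "vpath p G"
  shows "(\<Sum>v \<in> V. end_mult v p) \<le> 2"
proof -
  have "(\<Sum>v \<in> V. end_mult v p) = (\<Sum>v \<in> V. of_bool (hd p = v)) + (\<Sum>v \<in> V. of_bool (last p = v))"
    using assms(2) by (simp add: end_mult_vpath sum.distrib)
  also have "\<dots> \<le> 1 + 1"
    using assms(1) by (intro add_mono) (simp_all add: of_bool_def)
  finally show ?thesis by simp
qed

text \<open>Double counting of path ends: each vertex requires at least \<open>f v\<close> of them,
  and each path supplies at most two.\<close>

lemma sum_le_cover:
  assumes fin: "finite (verts G)" and C: "isometric_path_cover G f C"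
  shows "(\<Sum>v \<in> verts G. f v) \<le> 2 * size C"
proof -
  have "(\<Sum>v \<in> verts G. f v) \<le> (\<Sum>v \<in> verts G. \<Sum>p \<in># C. end_mult v p)"
  proof (rule sum_mono)
    fix v assume "v \<in> verts G"
    then show "f v \<le> (\<Sum>p \<in># C. end_mult v p)"
      using C by (cases "f v") (auto simp: isometric_path_cover_def)
  qed
  also have "\<dots> = (\<Sum>p \<in># C. \<Sum>v \<in> verts G. end_mult v p)"
    by (induction C) (simp_all add: sum.distrib)
  also have "\<dots> \<le> (\<Sum>p \<in># C. 2)"
    using C fin
    by (intro sum_mset_mono sum_end_mult_le) (auto simp: isometric_path_cover_def isometric_path_def)
  finally show ?thesis by simp
qed

text \<open>The multiplicities in \<open>M\<close> only need to dominate \<open>f\<close>, which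
  leaves room for the extra entry when the sum of labels is odd.\<close>

lemma (in graph) ex_isometric_path_cover:
  assumes bg: "block_graph G" and conn: "connected G" and reg: "regular_labeling G f"
    and M: "set_mset M \<subseteq> verts G" "even (size M)" "\<And>v. v \<in> verts G \<Longrightarrow> f v \<le> count M v"
  shows "\<exists>C. isometric_path_cover G f C \<and> 2 * size C = size M"
proof -
  have "v \<in># M" if "v \<in> verts G" "\<not> cut_vertex G v" for v
  proof -
    have "1 \<le> f v"
      using reg that by (simp add: regular_labeling_def)
    then show ?thesis
      using M(3)[OF that(1)] by (simp add: count_greater_zero_iff[symmetric] del: count_greater_zero_iff)
  qed
  then obtain P where P: "image_mset fst P + image_mset snd P = M"
    and sep: "\<And>v. cut_vertex G v \<Longrightarrow> \<exists>(a, b) \<in># P. \<not> a \<rightarrow>\<^sup>*\<^bsub>del_vert v\<^esub> b"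
    using separating_pairingE[OF bg conn M(1,2)] by blast
  define g where "g a b = (SOME p. isometric_path G p \<and> hd p = a \<and> last p = b)" for a b
  have g: "isometric_path G (g a b)" "hd (g a b) = a" "last (g a b) = b"
    if "a \<in> verts G" "b \<in> verts G" for a b
  proof -
    have "a \<rightarrow>\<^sup>* b"
      using conn that by (simp add: connected_iff)
    then obtain p where "vpath p G" "hd p = a" "last p = b" "length p = Suc (vdist a b)"
      by (rule shortest_vpathE)
    then have "\<exists>p. isometric_path G p \<and> hd p = a \<and> last p = b"
      using isometric_pathI[of p] by blast
    from someI_ex[OF this] show "isometric_path G (g a b)" "hd (g a b) = a" "last (g a b) = b"
      by (simp_all add: g_def)
  qed
  have verts: "a \<in> verts G" "b \<in> verts G" if "(a, b) \<in># P" for a b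
  proof -
    have "a \<in># M" "b \<in># M"
      using that unfolding P[symmetric] by force+
    then show "a \<in> verts G" "b \<in> verts G" using M(1) by auto
  qed
  define C where "C = image_mset (\<lambda>(a, b). g a b) P"
  have "isometric_path_cover G f C"
    unfolding isometric_path_cover_def
  proof (intro conjI ballI impI)
    fix p assume "p \<in># C"
    then show "isometric_path G p"
      using g(1) verts by (auto simp: C_def)
  next
    fix v assume v: "v \<in> verts G" "f v = 0"
    then have "cut_vertex G v"
      using reg by (force simp: regular_labeling_def)
    then obtain a b where ab: "(a, b) \<in># P" "\<not> a \<rightarrow>\<^sup>*\<^bsub>del_vert v\<^esub> b"
      using sep by blast
    \<comment> \<open>The ends of this path are separated by \<open>v\<close>, so the path cannot
      avoid \<open>v\<close>.\<close>
    have "v \<in> set (g a b)"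
    proof (rule ccontr)
      assume "v \<notin> set (g a b)"
      moreover have "vwalk (g a b) G"
        using g(1)[OF verts[OF ab(1)]] by (auto simp: isometric_path_def)
      ultimately have "hd (g a b) \<rightarrow>\<^sup>*\<^bsub>del_vert v\<^esub> last (g a b)"
        by (intro reachable_del_vertI)
      then show False
        using ab(2) g(2,3)[OF verts[OF ab(1)]] by simp
    qed
    moreover have "g a b \<in># C"
      using ab(1) by (force simp: C_def)
    ultimately show "\<exists>p \<in># C. v \<in> set p"
      by blast
  next
    fix v assume v: "v \<in> verts G" "1 \<le> f v"
    \<comment> \<open>The ends of the chosen paths are exactly the entries of the pairs, so the ends
      at \<open>v\<close> number \<open>count M v\<close>.\<close>
    have "(\<Sum>p \<in># C. end_mult v p) = (\<Sum>q \<in># P. of_bool (fst q = v) + of_bool (snd q = v))"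
      unfolding C_def image_mset.compositionality
    proof (intro arg_cong[where f = sum_mset] image_mset_cong)
      fix q assume "q \<in># P"
      then show "((\<lambda>p. end_mult v p) \<circ> (\<lambda>(a, b). g a b)) q = of_bool (fst q = v) + of_bool (snd q = v)"
        using g verts end_mult_vpath[of _ G] by (cases q) (simp add: isometric_path_def)
    qed
    also have "\<dots> = count M v"
      unfolding P[symmetric] by (induction P) auto
    finally show "f v \<le> (\<Sum>p \<in># C. end_mult v p)"
      using M(3)[OF v(1)] by simp
  qed
  moreover have "2 * size C = size M"
    unfolding P[symmetric] C_def by simp
  ultimately show ?thesis
    by blast
qed

theorem theorem3:
  fixes G :: "('a, 'b) pre_digraph" and f :: "'a \<Rightarrow> nat"
  assumes "block_graph G"
    and "Digraph_Component.connected G"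
    and "regular_labeling G f"
  shows "int (isometric_path_number G f) = \<lceil>real (\<Sum>v \<in> verts G. f v) / 2\<rceil>"
proof -
  interpret graph G
    using assms(1) by (simp add: block_graph_def)
  define s where "s = (\<Sum>v \<in> verts G. f v)"
  define N where "N = (\<Sum>v \<in> verts G. replicate_mset (f v) v)"
  have count_N: "count N v = f v" if "v \<in> verts G" for v
    using that by (simp add: N_def count_sum sum.delta)
  have size_N: "size N = s"
    by (simp add: N_def s_def size_multiset_sum)
  have set_N: "set_mset N \<subseteq> verts G"
    by (auto simp: N_def set_mset_sum split: if_splits)
  obtain x where x: "x \<in> verts G"
    using assms(2) by (auto simp: connected_iff)
  \<comment> \<open>The size of \<open>M\<close> is \<open>s\<close> rounded up to an even number,
    that is, twice the claimed value.\<close>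
  define M where "M = (if even s then N else add_mset x N)"
  have M: "set_mset M \<subseteq> verts G" "even (size M)" "\<And>v. v \<in> verts G \<Longrightarrow> f v \<le> count M v"
    using set_N size_N count_N x by (auto simp: M_def)
  obtain C where C: "isometric_path_cover G f C" "2 * size C = size M"
    using ex_isometric_path_cover[OF assms M] by blast
  have "isometric_path_number G f = size C"
    unfolding isometric_path_number_def
  proof (rule Least_equality)
    fix k assume "\<exists>C. isometric_path_cover G f C \<and> size C = k"
    then have "s \<le> 2 * k"
      using sum_le_cover[of G f] by (auto simp: s_def)
    \<comment> \<open>Together with \<open>s \<le> 2 * k\<close> this gives
      \<open>2 * size C \<le> 2 * k + 1\<close>, and integrality yields
      \<open>size C \<le> k\<close>.\<close>
    moreover have "2 * size C \<le> Suc s"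
      using C(2) size_N by (simp add: M_def split: if_splits)
    ultimately show "size C \<le> k"
      by (cases "even s") (use C(2) size_N in \<open>auto simp: M_def elim!: oddE\<close>)
  qed (use C(1) in blast)
  moreover have "\<lceil>real s / 2\<rceil> = int (size C)"
    using C(2) size_N by (intro ceiling_unique) (auto simp: M_def split: if_splits)
  ultimately show ?thesis
    by (simp add: s_def)
qed

end
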